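(* Let $R$ be a finitely generated rng with $R^2=R$ and let $n\ge 3$ be an integer. Then $\mathrm{E}_n(R)$ is a finitely generated perfect group such that $$\frac{w(R)}{n^2}\;\le\; w(\mathrm{E}_n(R))\;\le\;\left\lceil \frac{2\,w(R)}{n^2-n-2}\right\rceil .$$
   Context: A rng is an associative ring that is not required to have a multiplicative unit. For a rng $R$, $R^2$ denotes the additive subgroup generated by $\{xy : x,y\in R\}$. A rng is finitely generated if it is generated as a rng by finitely many elements. $R^+$ denotes the unitization of $R$ (the ring $\mathbf{Z}\oplus R$ with unit $(1,0)$, containing $R$ as a two-sided ideal). For $1\le i\neq j\le n$ and $r\in R$, $E_{i,j}(r)\in \mathrm{GL}_n(R^+)$ is the elementary matrix with $1$'s on the diagonal, $r$ in the $(i,j)$-th entry and $0$'s elsewhere; $\mathrm{E}_n(R)$ is the subgroup of $\mathrm{GL}_n(R^+)$ generated by all $E_{i,j}(r)$ with $1\le i\ne j\le n$, $r\in R$. A group $G$ is perfect if $G=[G,G]$. The weight $w(R)$ of a rng $R$ is the minimum of the positive integers $m$ such that $R$ is generated by $m$ elements as a two-sided ideal, where the two-sided ideal generated by $Z\subseteq R$ is the additive subgroup generated by $Z\cup RZ\cup ZR\cup RZR$. The weight $w(G)$ of a group $G$ is the minimum of the positive integers $m$ such that $G$ is generated by $m$ elements as a normal subgroup. *)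

theory Defs
  imports
    "HOL-Algebra.Generated_Groups"
    "HOL-Computational_Algebra.Group_Closure"
    "Jordan_Normal_Form.Gauss_Jordan_Elimination"
begin

text \<open>
  The type class \<^class>\<open>ring\<close> does not require a multiplicative unit, so a rng \<open>R\<close> is a type
  \<open>'a\<close> of that class, and \<open>R\<close> itself is \<open>UNIV :: 'a set\<close>.
\<close>

inductive_set rng_closure :: "'a::ring set \<Rightarrow> 'a set" for S where
  base: "s \<in> insert 0 S \<Longrightarrow> s \<in> rng_closure S"
| diff: "s \<in> rng_closure S \<Longrightarrow> t \<in> rng_closure S \<Longrightarrow> s - t \<in> rng_closure S"
| mult: "s \<in> rng_closure S \<Longrightarrow> t \<in> rng_closure S \<Longrightarrow> s * t \<in> rng_closure S"

definition finitely_generated_rng :: "'a::ring itself \<Rightarrow> bool" where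
  "finitely_generated_rng _ \<longleftrightarrow> (\<exists>S::'a set. finite S \<and> rng_closure S = UNIV)"

definition rng_square :: "'a::ring set" where
  "rng_square = group_closure {x * y | x y. True}"

definition rng_ideal_closure :: "'a::ring set \<Rightarrow> 'a set" where
  "rng_ideal_closure Z = group_closure
     (Z \<union> {r * z | r z. z \<in> Z} \<union> {z * r | r z. z \<in> Z} \<union> {r * z * s | r z s. z \<in> Z})"

text \<open>
  The two weights below are meaningful only if some generating family exists, which is the case
  for finitely generated rngs and groups. Generators are given as families, so they may repeat;
  this does not change the minimum.
\<close>

definition rng_weight :: "'a::ring itself \<Rightarrow> nat" where
  "rng_weight _ = (LEAST m. 0 < m \<and> (\<exists>z :: nat \<Rightarrow> 'a. rng_ideal_closure (z ` {..<m}) = UNIV))"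

definition int_smult :: "int \<Rightarrow> 'a::ab_group_add \<Rightarrow> 'a" where
  "int_smult k r = (\<Sum>_<nat k. r) - (\<Sum>_<nat (- k). r)"

lemma sum_const_add: "(\<Sum>_<m + n. r) = (\<Sum>_<m. r) + (\<Sum>_<n. r)" for m n :: nat and r :: "'a::ab_group_add"
  by (induction n) (simp_all add: algebra_simps)

lemma int_smult_diff: "int_smult (int m - int n) r = (\<Sum>_<m. r) - (\<Sum>_<n. r)"
proof (cases "n \<le> m")
  case True
  then obtain k where "m = n + k" by (auto simp: le_iff_add)
  then show ?thesis by (simp add: int_smult_def sum_const_add)
next
  case False
  then obtain k where "n = m + k" by (metis le_iff_add nat_le_linear)
  then show ?thesis by (simp add: int_smult_def sum_const_add)
qed

lemma int_smult_0_left [simp]: "int_smult 0 r = 0"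
  by (simp add: int_smult_def)

lemma int_smult_1_left [simp]: "int_smult 1 r = r"
  by (simp add: int_smult_def)

lemma int_smult_0_right [simp]: "int_smult k 0 = 0"
  by (simp add: int_smult_def)

lemma int_smult_add_left: "int_smult (k + l) r = int_smult k r + int_smult l r"
proof -
  obtain a b where k: "k = int a - int b" using int_diff_cases by blast
  obtain c d where l: "l = int c - int d" using int_diff_cases by blast
  have "k + l = int (a + c) - int (b + d)" by (simp add: k l)
  then show ?thesis
    by (simp only: int_smult_diff k l sum_const_add) (simp add: algebra_simps)
qed

lemma int_smult_add_right: "int_smult k (r + s) = int_smult k r + int_smult k s"
  by (simp add: int_smult_def sum.distrib algebra_simps)

lemma int_smult_mult_left: "int_smult k r * s = int_smult k (r * s)" for r s :: "'a::ring"
  by (simp add: int_smult_def left_diff_distrib sum_distrib_right)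

lemma int_smult_mult_right: "r * int_smult k s = int_smult k (r * s)" for r s :: "'a::ring"
  by (simp add: int_smult_def right_diff_distrib sum_distrib_left)

lemma int_smult_minus_left: "int_smult (- k) r = - int_smult k r"
  by (simp add: int_smult_def)

lemma int_smult_assoc: "int_smult (k * l) r = int_smult k (int_smult l r)"
proof (induction k rule: int_induct [of _ 0])
  case base
  show ?case by simp
next
  case (step1 i)
  then show ?case by (simp add: distrib_right int_smult_add_left)
next
  case (step2 i)
  have "int_smult ((i - 1) * l) r = int_smult (i * l) r + int_smult (- l) r"
    by (simp add: int_smult_add_left [symmetric] algebra_simps)
  moreover have "int_smult (i - 1) s = int_smult i s - s" for s :: 'a
    using int_smult_add_left [of "i - 1" 1 s] by (simp add: algebra_simps)
  ultimately show ?case using step2 by (simp add: int_smult_minus_left)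
qed

datatype 'a unitization = Unitization (scalar_part: int) (rng_part: 'a)

instantiation unitization :: (ring) ring_1
begin

definition zero_unitization where "0 = Unitization 0 0"
definition one_unitization where "1 = Unitization 1 0"
definition plus_unitization where
  "x + y = Unitization (scalar_part x + scalar_part y) (rng_part x + rng_part y)"
definition uminus_unitization where
  "- x = Unitization (- scalar_part x) (- rng_part x)"
definition minus_unitization where
  "x - y = Unitization (scalar_part x - scalar_part y) (rng_part x - rng_part y)"
definition times_unitization where
  "x * y = Unitization (scalar_part x * scalar_part y)
     (int_smult (scalar_part x) (rng_part y) + int_smult (scalar_part y) (rng_part x)
       + rng_part x * rng_part y)"

instance
proof
  fix x y z :: "'a unitization"
  show "x * y * z = x * (y * z)"
    by (simp add: times_unitization_def algebra_simps int_smult_add_right int_smult_mult_left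
        int_smult_mult_right int_smult_assoc [symmetric])
qed (auto simp: zero_unitization_def one_unitization_def plus_unitization_def
    uminus_unitization_def minus_unitization_def times_unitization_def algebra_simps
    int_smult_add_left int_smult_add_right intro: unitization.expand)

end

definition finitely_generated_group :: "('a, 'b) monoid_scheme \<Rightarrow> bool" where
  "finitely_generated_group G \<longleftrightarrow>
     group G \<and> (\<exists>S. finite S \<and> S \<subseteq> carrier G \<and> generate G S = carrier G)"

definition perfect_group :: "('a, 'b) monoid_scheme \<Rightarrow> bool" where
  "perfect_group G \<longleftrightarrow> group G \<and> derived G (carrier G) = carrier G"

definition normal_closure :: "('a, 'b) monoid_scheme \<Rightarrow> 'a set \<Rightarrow> 'a set" where
  "normal_closure G S = \<Inter> {N. N \<lhd> G \<and> S \<subseteq> N}"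

definition group_weight :: "('a, 'b) monoid_scheme \<Rightarrow> nat" where
  "group_weight G = (LEAST m. 0 < m \<and>
     (\<exists>g :: nat \<Rightarrow> 'a. g ` {..<m} \<subseteq> carrier G \<and> normal_closure G (g ` {..<m}) = carrier G))"

definition GL :: "'a::ring_1 itself \<Rightarrow> nat \<Rightarrow> 'a mat monoid" where
  "GL ty n = units_of (ring_mat ty n ())"

text \<open>
  Matrix indices run through \<open>{0..<n}\<close>; \<^term>\<open>addrow_mat n a i j\<close> has entry \<open>a\<close> at
  position \<open>(i, j)\<close> when \<open>i \<noteq> j\<close> and agrees with the identity matrix elsewhere.
\<close>

definition elementary_matrix :: "nat \<Rightarrow> nat \<Rightarrow> nat \<Rightarrow> 'a::ring \<Rightarrow> 'a unitization mat" where
  "elementary_matrix n i j r = addrow_mat n (Unitization 0 r) i j"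

definition elementary_group :: "'a::ring itself \<Rightarrow> nat \<Rightarrow> 'a unitization mat monoid" where
  "elementary_group _ n =
     (let G = GL TYPE('a unitization) n in
      G\<lparr>carrier := generate G
         {elementary_matrix n i j r | i j (r :: 'a). i < n \<and> j < n \<and> i \<noteq> j}\<rparr>)"

end

theory Submission
  imports Defs
begin

text \<open>
  Write \<open>T i j r\<close> for the elementary matrix with \<open>r\<close> at position \<open>(i, j)\<close>, and \<open>E\<close> for the group that
  these matrices generate. Everything rests on the commutator relation
  \<open>[T i j r, T j k s] = T i k (r * s)\<close> for distinct \<open>i\<close>, \<open>j\<close>, \<open>k\<close>. As there are at least three
  indices, any position \<open>(i, k)\<close> can be reached in this way. So if a subgroup of \<open>E\<close> contains all
  \<open>T i j s\<close> with \<open>s\<close> in a set \<open>S\<close>, then the \<open>r\<close> for which it contains all \<open>T i j r\<close> form a subrng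
  containing \<open>S\<close>, and \<open>E\<close> is finitely generated as soon as the rng is. Similarly, \<open>T i k (r * s)\<close>
  is a commutator, so idempotence of the rng makes \<open>E\<close> perfect.

  For the lower bound on the weight of \<open>E\<close>, let \<open>I\<close> be the ideal generated by the rng parts of
  all entries of a family of \<open>m\<close> normal generators; it has at most \<open>m * n\<^sup>2\<close> generators. The matrices
  congruent to the identity modulo \<open>I\<close> form a normal subgroup (\<open>normal_congruence_subgroup\<close>). It
  contains the generators, hence every \<open>T 0 1 r\<close>, so \<open>I\<close> is the whole rng (\<open>rng_weight_le\<close>).

  For the upper bound, ideal generators are packed into unitriangular matrices, filling every position
  above the diagonal except the corner \<open>(0, n - 1)\<close>; this accommodates \<open>(n\<^sup>2 - n - 2) / 2\<close> of
  them per matrix. Let a normal subgroup \<open>N\<close> contain such a matrix \<open>g\<close>. Comparing \<open>g\<close> with its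
  conjugates by the \<open>T 0 k r\<close> puts into \<open>N\<close> a matrix whose only nontrivial row is the top one,
  filled with \<open>r\<close> times the part of row \<open>k\<close> of \<open>g\<close> to the right of the diagonal. One more
  commutator isolates a single entry \<open>z\<close> of \<open>g\<close> and yields \<open>T 0 1 (r * z * s) \<in> N\<close>. This reaches
  all rows but the top one, and the dual argument on columns reaches all columns but the last one;
  only the corner escapes. Since the rng is idempotent, elements \<open>r * z * s\<close> at one position
  spread to all positions, and the \<open>z\<close> for which all \<open>T i j (r * z * s)\<close> are in \<open>N\<close> form a
  two-sided ideal (\<open>normal_eq_E_of_ideal_generators\<close>). If the packed entries generate the rng as an
  ideal, then \<open>N\<close> contains every \<open>T i j (r * z * s)\<close>, and idempotence gives \<open>N = E\<close>.
\<close>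

section \<open>Idempotent rngs and commutators\<close>

text \<open>
  Idempotence is always used in this form: an additive property that holds for products holds
  for all elements.
\<close>

lemma idempotent_subgroup_eq_UNIV:
  fixes A :: "'a::ring set"
  assumes "(rng_square :: 'a set) = UNIV"
    and zero: "0 \<in> A" and diff: "\<And>x y. x \<in> A \<Longrightarrow> y \<in> A \<Longrightarrow> x - y \<in> A"
    and prod: "\<And>x y. x * y \<in> A"
  shows "A = UNIV"
proof -
  have "r \<in> A" if "r \<in> rng_square" for r
    using that unfolding rng_square_def
    by (induction rule: group_closure.induct) (auto simp: zero diff prod)
  then show ?thesis
    using assms(1) by auto
qed

text \<open>
  Commutators of matrices are used in the inverse-free form \<open>g * h = c * (h * g)\<close>, which can be
  checked entry by entry.
\<close>

lemma (in group) commutator_eqI: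
  assumes "g \<in> carrier G" "h \<in> carrier G" "c \<in> carrier G" "g \<otimes> h = c \<otimes> (h \<otimes> g)"
  shows "c = g \<otimes> h \<otimes> inv g \<otimes> inv h"
proof -
  have "c = g \<otimes> h \<otimes> inv (h \<otimes> g)"
    using assms by (intro inv_solve_right [THEN iffD2]) auto
  also have "\<dots> = g \<otimes> h \<otimes> inv g \<otimes> inv h"
    using assms(1,2) by (simp add: inv_mult_group m_assoc)
  finally show ?thesis .
qed

lemma (in group) commutator_mem_subgroup:
  assumes "subgroup H G" "g \<in> H" "h \<in> H" "c \<in> carrier G" "g \<otimes> h = c \<otimes> (h \<otimes> g)"
  shows "c \<in> H"
proof -
  interpret H: subgroup H G by fact
  have "g \<otimes> h \<otimes> inv g \<otimes> inv h \<in> H"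
    using assms(2,3) by simp
  then show ?thesis
    using commutator_eqI [of g h c] assms(2-5) H.mem_carrier by metis
qed

lemma (in group) commutator_mem_normal_left:
  assumes "N \<lhd> G" "g \<in> N" "h \<in> carrier G" "c \<in> carrier G" "g \<otimes> h = c \<otimes> (h \<otimes> g)"
  shows "c \<in> N"
proof -
  interpret N: normal N G by fact
  have g: "g \<in> carrier G"
    using assms(2) by (rule N.mem_carrier)
  have "g \<otimes> (h \<otimes> inv g \<otimes> inv h) \<in> N"
    using assms(2) N.inv_op_closed2 [OF assms(3) N.m_inv_closed [OF assms(2)]] by (rule N.m_closed)
  also have "g \<otimes> (h \<otimes> inv g \<otimes> inv h) = g \<otimes> h \<otimes> inv g \<otimes> inv h"
    using g assms(3) by (simp add: m_assoc)
  also have "\<dots> = c"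
    using commutator_eqI [OF g assms(3-5)] by (rule sym)
  finally show ?thesis .
qed

lemma (in group) commutator_mem_normal_right:
  assumes "N \<lhd> G" "g \<in> carrier G" "h \<in> N" "c \<in> carrier G" "g \<otimes> h = c \<otimes> (h \<otimes> g)"
  shows "c \<in> N"
proof -
  interpret N: normal N G by fact
  have h: "h \<in> carrier G"
    using assms(3) by (rule N.mem_carrier)
  have "g \<otimes> h \<otimes> inv g \<otimes> inv h \<in> N"
    using N.inv_op_closed2 [OF assms(2,3)] N.m_inv_closed [OF assms(3)] by (rule N.m_closed)
  also have "g \<otimes> h \<otimes> inv g \<otimes> inv h = c"
    using commutator_eqI [OF assms(2) h assms(4,5)] by (rule sym)
  finally show ?thesis .
qed

text \<open>
  The element \<open>c\<close> is the commutator of \<open>inv t\<close> and \<open>inv g\<close>, with the factor standing on the side on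
  which it appears in \<open>row_conjugation\<close> below.
\<close>

lemma (in group) conjugation_quotient_mem_normal:
  assumes "N \<lhd> G" "g \<in> N" "t \<in> carrier G" "c \<in> carrier G" "t \<otimes> g = g \<otimes> (t \<otimes> c)"
  shows "c \<in> N"
proof -
  interpret N: normal N G by fact
  have g: "g \<in> carrier G"
    using assms(2) by (rule N.mem_carrier)
  have "inv t \<otimes> inv g \<otimes> t \<otimes> g = inv t \<otimes> (inv g \<otimes> (t \<otimes> g))"
    using g assms(3) by (simp add: m_assoc)
  also have "\<dots> = c"
    unfolding assms(5) using g assms(3,4) by (simp add: m_assoc [symmetric])
  finally show ?thesis
    using N.m_closed [OF N.inv_op_closed1 [OF assms(3) N.m_inv_closed [OF assms(2)]] assms(2)] by simp
qed

section \<open>Elementary matrices and the group they generate\<close>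

lemma index_mult_mat_sum:
  assumes "A \<in> carrier_mat n n" "B \<in> carrier_mat n n" "i < n" "j < n"
  shows "(A * B) $$ (i, j) = (\<Sum>k<n. A $$ (i, k) * B $$ (k, j))"
  using assms by (auto simp: scalar_prod_def atLeast0LessThan intro!: sum.cong)

lemma index_addrow_mat_mult:
  assumes "A \<in> carrier_mat n n" "p < n" "q < n" "i < n" "j < n"
  shows "(addrow_mat n x p q * A) $$ (i, j) = A $$ (i, j) + (if i = p then x * A $$ (q, j) else 0)"
  using assms by (subst addrow_mat [OF assms(1,3), symmetric]) (auto simp: add.commute)

lemma index_mult_addrow_mat:
  assumes "A \<in> carrier_mat n n" "p < n" "q < n" "i < n" "j < n"
  shows "(A * addrow_mat n x p q) $$ (i, j) = A $$ (i, j) + (if j = q then A $$ (i, p) * x else 0)"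
proof -
  have "(A * addrow_mat n x p q) $$ (i, j) = (\<Sum>k<n. A $$ (i, k) * addrow_mat n x p q $$ (k, j))"
    using assms by (intro index_mult_mat_sum) auto
  also have "\<dots> = (\<Sum>k<n. (if k = j then A $$ (i, k) else 0)
      + (if k = p then (if j = q then A $$ (i, p) * x else 0) else 0))"
    using assms by (intro sum.cong) (auto simp: distrib_left add.commute)
  finally show ?thesis
    using assms by (simp add: sum.distrib)
qed

lemma unitization_simps [simp]:
  "Unitization 0 r + Unitization 0 s = Unitization 0 (r + s)"
  "Unitization 0 r * Unitization 0 s = Unitization 0 (r * s)"
  "Unitization 0 0 = 0"
  by (simp_all add: plus_unitization_def times_unitization_def zero_unitization_def)

lemma unitization_part_simps [simp]:
  "scalar_part 0 = 0" "scalar_part 1 = 1" "scalar_part (x - y) = scalar_part x - scalar_part y"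
  "rng_part 0 = 0" "rng_part 1 = 0" "rng_part (x - y) = rng_part x - rng_part y"
  by (simp_all add: zero_unitization_def one_unitization_def minus_unitization_def del: unitization_simps)

text \<open>
  The rng is a type, which the parameter \<open>R\<close> fixes.
\<close>

locale elementary =
  fixes n :: nat and R :: "'a::ring itself"
begin

abbreviation E :: "'a unitization mat monoid" where
  "E \<equiv> elementary_group TYPE('a) n"

abbreviation T :: "nat \<Rightarrow> nat \<Rightarrow> 'a \<Rightarrow> 'a unitization mat" where
  "T \<equiv> elementary_matrix n"

abbreviation ambient :: "'a unitization mat monoid" where
  "ambient \<equiv> GL TYPE('a unitization) n"

lemma group_ambient: "group ambient"
  unfolding GL_def
  by (rule monoid.units_group) (metis semiring.axioms(2) semiring_mat)

lemma mult_E [simp]: "x \<otimes>\<^bsub>E\<^esub> y = x * y"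
  by (simp add: elementary_group_def GL_def units_of_def ring_mat_simps Let_def)

lemma one_E [simp]: "\<one>\<^bsub>E\<^esub> = 1\<^sub>m n"
  by (simp add: elementary_group_def GL_def units_of_def ring_mat_simps Let_def)

lemma T_carrier_mat [simp]: "T i j r \<in> carrier_mat n n"
  by (simp add: elementary_matrix_def)

lemma T_mult_T:
  assumes "i < n" "j < n" "i \<noteq> j"
  shows "T i j r * T i j s = T i j (r + s)"
proof (rule eq_matI, goal_cases)
  case (1 p q)
  then show ?case
    unfolding elementary_matrix_def
    using assms by (subst index_addrow_mat_mult) (auto simp: algebra_simps)
qed (auto simp: elementary_matrix_def)

lemma T_0: "T i j 0 = 1\<^sub>m n"
  by (rule eq_matI) (auto simp: elementary_matrix_def)

lemma T_in_ambient:
  assumes "i < n" "j < n" "i \<noteq> j"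
  shows "T i j r \<in> carrier ambient"
proof -
  have "T i j r * T i j (- r) = 1\<^sub>m n" "T i j (- r) * T i j r = 1\<^sub>m n"
    using assms by (simp_all add: T_mult_T T_0)
  then show ?thesis
    by (auto simp: GL_def units_of_def Units_def ring_mat_simps intro!: bexI [of _ "T i j (- r)"])
qed

lemma E_eq: "E = ambient\<lparr>carrier := generate ambient {T i j r | i j r. i < n \<and> j < n \<and> i \<noteq> j}\<rparr>"
  by (simp add: elementary_group_def Let_def)

lemma subgroup_E: "subgroup (carrier E) ambient"
proof -
  have "{T i j r | i j r. i < n \<and> j < n \<and> i \<noteq> j} \<subseteq> carrier ambient"
    using T_in_ambient by blast
  then show ?thesis
    using group.generate_is_subgroup [OF group_ambient] by (simp add: E_eq)
qed

lemma group_E: "group E"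
  using group.subgroup_imp_group [OF group_ambient subgroup_E]
  by (simp add: E_eq)

sublocale E: group E
  by (rule group_E)

lemma carrier_E_mat: "g \<in> carrier E \<Longrightarrow> g \<in> carrier_mat n n"
  using subgroup.subset [OF subgroup_E]
  by (auto simp: GL_def units_of_def Units_def ring_mat_simps)

lemma T_in_E: "i < n \<Longrightarrow> j < n \<Longrightarrow> i \<noteq> j \<Longrightarrow> T i j r \<in> carrier E"
  by (auto simp: E_eq intro!: generate.incl)

text \<open>
  With this criterion, all later arguments about generation take place inside \<open>E\<close> instead of the ambient
  general linear group.
\<close>

lemma subgroup_eq_E:
  assumes "subgroup H E" and "\<And>i j r. i < n \<Longrightarrow> j < n \<Longrightarrow> i \<noteq> j \<Longrightarrow> T i j r \<in> H"
  shows "H = carrier E"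
proof
  show "H \<subseteq> carrier E"
    using assms(1) by (rule subgroup.subset)
  have "subgroup H ambient"
    using group.incl_subgroup [OF group_ambient subgroup_E] assms(1) by (simp add: E_eq)
  then show "carrier E \<subseteq> H"
    using assms(2) by (subst E_eq, simp) (rule group.generate_subgroup_incl [OF group_ambient], auto)
qed

lemma T_commutator:
  assumes "i < n" "j < n" "k < n" "i \<noteq> j" "j \<noteq> k" "i \<noteq> k"
  shows "T i j r * T j k s = T i k (r * s) * (T j k s * T i j r)"
proof (rule eq_matI, goal_cases)
  case (1 p q)
  then have pq: "p < n" "q < n"
    by (auto simp: elementary_matrix_def)
  show ?case
    unfolding elementary_matrix_def
    using assms pq by (simp add: index_addrow_mat_mult mult_carrier_mat [of _ n n] del: index_mult_mat)
qed (auto simp: elementary_matrix_def)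

section \<open>Finite generation and perfectness\<close>

text \<open>
  For fixed \<open>(i, j)\<close> the map \<open>T i j\<close> is additive, so the \<open>r\<close> with \<open>T i j r \<in> H\<close> form an additive
  subgroup of the rng.
\<close>

lemma root_subgroup:
  assumes "subgroup H E" "i < n" "j < n" "i \<noteq> j"
  shows "T i j 0 \<in> H" "T i j r \<in> H \<Longrightarrow> T i j s \<in> H \<Longrightarrow> T i j (r - s) \<in> H"
proof -
  interpret H: subgroup H E by fact
  show "T i j 0 \<in> H"
    using H.one_closed by (simp add: T_0)
  assume r: "T i j r \<in> H" and s: "T i j s \<in> H"
  have "inv\<^bsub>E\<^esub> T i j s = T i j (- s)"
    using assms(2-4) by (intro E.inv_equality) (auto simp: T_mult_T T_0 T_in_E)
  then have "T i j (- s) \<in> H"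
    using H.m_inv_closed [OF s] by simp
  then have "T i j r * T i j (- s) \<in> H"
    using H.m_closed [OF r] by simp
  then show "T i j (r - s) \<in> H"
    using assms(2-4) by (simp add: T_mult_T)
qed

lemma T_product_mem:
  assumes "subgroup H E" "i < n" "j < n" "k < n" "i \<noteq> j" "j \<noteq> k" "i \<noteq> k"
    and "T i j r \<in> H" "T j k s \<in> H"
  shows "T i k (r * s) \<in> H"
proof -
  have "T i j r \<otimes>\<^bsub>E\<^esub> T j k s = T i k (r * s) \<otimes>\<^bsub>E\<^esub> (T j k s \<otimes>\<^bsub>E\<^esub> T i j r)"
    unfolding mult_E by (rule T_commutator [OF assms(2-7)])
  then show ?thesis
    using assms by (intro E.commutator_mem_subgroup [OF assms(1,8,9)] T_in_E)
qed

lemma third_index: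
  assumes "n \<ge> 3"
  obtains k where "k < n" "k \<noteq> i" "k \<noteq> j"
proof -
  have "card {i, j} < card {..<n}"
    using assms card_insert_le_m1 [of 2 "{j}" i] by simp
  then have "\<not> {..<n} \<subseteq> {i, j}"
    using card_mono [of "{i, j}" "{..<n}"] by auto
  then show ?thesis
    using that by blast
qed

text \<open>
  The subgroup generated by the \<open>T i j s\<close> with \<open>s\<close> from a finite generating set of the rng is everything:
  the \<open>r\<close> with \<open>T i j r\<close> in it for all positions at once are closed under multiplication, by
  choosing a third index between \<open>i\<close> and \<open>k\<close>.
\<close>

lemma finitely_generated_E:
  assumes "finitely_generated_rng TYPE('a)" "n \<ge> 3"
  shows "finitely_generated_group E"
proof -
  obtain S :: "'a set" where S: "finite S" "rng_closure S = UNIV"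
    using assms(1) by (auto simp: finitely_generated_rng_def)
  define X where "X = {T i j s | i j s. i < n \<and> j < n \<and> i \<noteq> j \<and> s \<in> S}"
  have "X \<subseteq> (\<lambda>(i, j, s). T i j s) ` ({..<n} \<times> {..<n} \<times> S)"
    by (force simp: X_def)
  then have "finite X"
    by (rule finite_subset) (simp add: S(1))
  have X: "X \<subseteq> carrier E"
    by (auto simp: X_def intro: T_in_E)
  then have sub: "subgroup (generate E X) E"
    by (rule E.generate_is_subgroup)
  have "\<forall>i j. i < n \<longrightarrow> j < n \<longrightarrow> i \<noteq> j \<longrightarrow> T i j r \<in> generate E X" if "r \<in> rng_closure S" for r
    using that
  proof (induction rule: rng_closure.induct)
    case (base s)
    then show ?case
      using root_subgroup(1) [OF sub] by (auto intro: generate.incl simp: X_def)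
  next
    case (diff s t)
    then show ?case
      using root_subgroup(2) [OF sub] by blast
  next
    case (mult s t)
    show ?case
    proof (intro allI impI)
      fix i k assume ik: "i < n" "k < n" "i \<noteq> k"
      obtain j where "j < n" "j \<noteq> i" "j \<noteq> k"
        using assms(2) by (rule third_index)
      then show "T i k (s * t) \<in> generate E X"
        using mult.IH ik by (intro T_product_mem [OF sub, of i j k]) auto
    qed
  qed
  then have "generate E X = carrier E"
    using S(2) by (intro subgroup_eq_E [OF sub]) auto
  then show ?thesis
    using \<open>finite X\<close> X group_E by (auto simp: finitely_generated_group_def)
qed

end

locale idempotent_elementary = elementary n R for n and R :: "'a::ring itself" +
  assumes rank: "n \<ge> 3"
    and idem: "(rng_square :: 'a set) = UNIV"
begin

lemma subgroup_eq_E_of_products: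
  assumes "subgroup H E" and "\<And>i j r s. i < n \<Longrightarrow> j < n \<Longrightarrow> i \<noteq> j \<Longrightarrow> T i j (r * s) \<in> H"
  shows "H = carrier E"
proof (rule subgroup_eq_E [OF assms(1)])
  fix i j r assume ij: "i < n" "j < n" "i \<noteq> j"
  have "{r. T i j r \<in> H} = UNIV"
    using root_subgroup [OF assms(1) ij] assms(2) [OF ij]
    by (intro idempotent_subgroup_eq_UNIV [OF idem]) auto
  then show "T i j r \<in> H"
    by auto
qed

lemma perfect_E: "perfect_group E"
proof -
  have sub: "subgroup (derived E (carrier E)) E"
    by (rule E.derived_is_subgroup) simp
  have "derived E (carrier E) = carrier E"
  proof (rule subgroup_eq_E_of_products [OF sub])
    fix i j r s assume ij: "i < n" "j < n" "i \<noteq> j"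
    obtain k where k: "k < n" "k \<noteq> i" "k \<noteq> j"
      using rank by (rule third_index)
    let ?g = "T i k r" and ?h = "T k j s"
    have mem: "?g \<in> carrier E" "?h \<in> carrier E" "T i j (r * s) \<in> carrier E"
      using ij k by (auto intro: T_in_E)
    have "?g \<otimes>\<^bsub>E\<^esub> ?h = T i j (r * s) \<otimes>\<^bsub>E\<^esub> (?h \<otimes>\<^bsub>E\<^esub> ?g)"
      unfolding mult_E using ij k by (intro T_commutator) auto
    with mem have "T i j (r * s) = ?g \<otimes>\<^bsub>E\<^esub> ?h \<otimes>\<^bsub>E\<^esub> inv\<^bsub>E\<^esub> ?g \<otimes>\<^bsub>E\<^esub> inv\<^bsub>E\<^esub> ?h"
      by (rule E.commutator_eqI)
    then show "T i j (r * s) \<in> derived E (carrier E)"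
      unfolding derived_def using mem by (intro generate.incl) blast
  qed
  then show ?thesis
    by (simp add: perfect_group_def group_E)
qed

end

section \<open>Extracting single entries of unitriangular matrices\<close>

context elementary
begin

definition unitriangular :: "(nat \<Rightarrow> nat \<Rightarrow> 'a) \<Rightarrow> 'a unitization mat" where
  "unitriangular f = mat n n (\<lambda>(i, j). if i = j then 1 else if i < j then Unitization 0 (f i j) else 0)"

lemma unitriangular_carrier_mat [simp]: "unitriangular f \<in> carrier_mat n n"
  by (simp add: unitriangular_def)

lemma index_unitriangular:
  "i < n \<Longrightarrow> j < n \<Longrightarrow> unitriangular f $$ (i, j) =
    (if i = j then 1 else if i < j then Unitization 0 (f i j) else 0)"
  by (simp add: unitriangular_def)

lemma index_T_mult:
  assumes "A \<in> carrier_mat n n" "p < n" "q < n" "i < n" "j < n"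
  shows "(T p q r * A) $$ (i, j) = A $$ (i, j) + (if i = p then Unitization 0 r * A $$ (q, j) else 0)"
  unfolding elementary_matrix_def using assms by (rule index_addrow_mat_mult)

lemma index_mult_T:
  assumes "A \<in> carrier_mat n n" "p < n" "q < n" "i < n" "j < n"
  shows "(A * T p q r) $$ (i, j) = A $$ (i, j) + (if j = q then A $$ (i, p) * Unitization 0 r else 0)"
  unfolding elementary_matrix_def using assms by (rule index_mult_addrow_mat)

lemma mult_carrier_mat_square [simp]:
  "A \<in> carrier_mat n n \<Longrightarrow> B \<in> carrier_mat n n \<Longrightarrow> A * B \<in> carrier_mat n n"
  by (rule mult_carrier_mat)

lemma mat_eqI:
  assumes "A \<in> carrier_mat n n" "B \<in> carrier_mat n n"
    and "\<And>i j. i < n \<Longrightarrow> j < n \<Longrightarrow> A $$ (i, j) = B $$ (i, j)"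
  shows "A = B"
  using assms by (intro eq_matI) auto

text \<open>
  As long as row \<open>q\<close> is still a row of the identity matrix, multiplication by \<open>T p q r\<close> changes just the
  entry at \<open>(p, q)\<close>.
\<close>

lemma unitriangular_update:
  assumes "p < q" "q < n" "f p q = 0" "\<And>j. f q j = 0"
  shows "T p q r * unitriangular f = unitriangular (f(p := (f p)(q := r)))"
  using assms by (intro mat_eqI) (auto simp: index_T_mult index_unitriangular simp del: index_mult_mat)

text \<open>
  The entries are filled in row by row from the top, so that the rows below the current one are
  trivial and \<open>unitriangular_update\<close> applies.
\<close>

lemma unitriangular_in_E: "unitriangular f \<in> carrier E"
proof -
  \<comment> \<open>the entries that have been filled in: those before \<open>(k, l)\<close> in lexicographic order\<close>
  define part where "part = (\<lambda>k l. unitriangular (\<lambda>i j. if i < k \<or> i = k \<and> j < l then f i j else 0))"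
  have row: "part k l \<in> carrier E" if "k < n" "l \<le> n" "part k 0 \<in> carrier E" for k l
    using that(2)
  proof (induction l)
    case 0
    show ?case by (fact that(3))
  next
    case (Suc l)
    show ?case
    proof (cases "k < l")
      case True
      have "part k (Suc l) = T k l (f k l) * part k l"
        unfolding part_def using True Suc.prems
        by (subst unitriangular_update) (auto intro!: arg_cong [of _ _ unitriangular] simp: fun_eq_iff)
      moreover have "T k l (f k l) \<in> carrier E" "part k l \<in> carrier E"
        using True Suc by (auto intro: T_in_E)
      ultimately show ?thesis
        using E.m_closed by (metis mult_E)
    next
      case False
      then have "part k (Suc l) = part k l"
        unfolding part_def by (intro mat_eqI) (auto simp: index_unitriangular)
      then show ?thesis
        using Suc by simp
    qed
  qed
  have "part k 0 \<in> carrier E" if "k \<le> n" for k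
    using that
  proof (induction k)
    case 0
    have "part 0 0 = 1\<^sub>m n"
      unfolding part_def by (intro mat_eqI) (auto simp: index_unitriangular)
    then show ?case
      using E.one_closed by simp
  next
    case (Suc k)
    have "part (Suc k) 0 = part k n"
      unfolding part_def by (intro mat_eqI) (auto simp: index_unitriangular)
    then show ?case
      using row [of k n] Suc by simp
  qed
  moreover have "unitriangular f = part n 0"
    unfolding part_def by (intro mat_eqI) (auto simp: index_unitriangular)
  ultimately show ?thesis
    by simp
qed

lemma mult_identity_plus_row:
  fixes A B :: "'b::ring_1 mat"
  assumes "A \<in> carrier_mat n n" "B \<in> carrier_mat n n" "i < n" "j < n" "p < n"
    and B: "\<And>l. l < n \<Longrightarrow> B $$ (l, j) = (if l = j then 1 else 0) + (if l = p then x else 0)"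
  shows "(A * B) $$ (i, j) = A $$ (i, j) + A $$ (i, p) * x"
proof -
  have "(A * B) $$ (i, j) = (\<Sum>l<n. A $$ (i, l) * B $$ (l, j))"
    by (rule index_mult_mat_sum [OF assms(1-4)])
  also have "\<dots> = (\<Sum>l<n. (if l = j then A $$ (i, l) else 0) + (if l = p then A $$ (i, l) * x else 0))"
    by (intro sum.cong refl) (simp add: B distrib_left)
  finally show ?thesis
    using assms(3-5) by (simp add: sum.distrib)
qed

lemma identity_plus_column_mult:
  fixes A B :: "'b::ring_1 mat"
  assumes "A \<in> carrier_mat n n" "B \<in> carrier_mat n n" "i < n" "j < n" "q < n"
    and A: "\<And>l. l < n \<Longrightarrow> A $$ (i, l) = (if l = i then 1 else 0) + (if l = q then x else 0)"
  shows "(A * B) $$ (i, j) = B $$ (i, j) + x * B $$ (q, j)"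
proof -
  have "(A * B) $$ (i, j) = (\<Sum>l<n. A $$ (i, l) * B $$ (l, j))"
    by (rule index_mult_mat_sum [OF assms(1-4)])
  also have "\<dots> = (\<Sum>l<n. (if l = i then B $$ (l, j) else 0) + (if l = q then x * B $$ (l, j) else 0))"
    by (intro sum.cong refl) (simp add: A distrib_right)
  finally show ?thesis
    using assms(3-5) by (simp add: sum.distrib)
qed

text \<open>
  Let \<open>g\<close> be the unitriangular matrix. Its column \<open>0\<close> is the first column of the identity, so
  conjugating \<open>T 0 k r\<close> to \<open>g\<^sup>-\<^sup>1 * T 0 k r * g\<close> leaves the change in row \<open>0\<close> but replaces the single entry
  \<open>r\<close> by \<open>r\<close> times row \<open>k\<close> of \<open>g\<close>. The diagonal entry of that row accounts for the factor
  \<open>T 0 k r\<close> on the right-hand side, and the remaining ones for the other factor.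
\<close>

lemma row_conjugation:
  assumes "0 < k" "k < n"
  shows "T 0 k r * unitriangular f =
    unitriangular f * (T 0 k r * unitriangular (\<lambda>i j. if i = 0 \<and> k < j then r * f k j else 0))"
    (is "_ = ?g * (_ * ?d)")
proof (intro mat_eqI)
  fix i j assume ij: "i < n" "j < n"
  have "(T 0 k r * ?d) $$ (l, j) =
      (if l = j then 1 else 0) + (if l = 0 then Unitization 0 r * ?g $$ (k, j) else 0)" if "l < n" for l
    using that ij assms
    by (auto simp: index_T_mult index_unitriangular simp del: index_mult_mat)
  then have "(?g * (T 0 k r * ?d)) $$ (i, j) = ?g $$ (i, j) + ?g $$ (i, 0) * (Unitization 0 r * ?g $$ (k, j))"
    using ij assms by (intro mult_identity_plus_row) simp_all
  also have "\<dots> = (T 0 k r * ?g) $$ (i, j)"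
    using ij assms by (subst index_T_mult) (auto simp: index_unitriangular)
  finally show "(T 0 k r * ?g) $$ (i, j) = (?g * (T 0 k r * ?d)) $$ (i, j)"
    by (rule sym)
qed simp_all

text \<open>
  The mirror image: the last row of \<open>g\<close> is trivial, and conjugation spreads column \<open>k\<close> of \<open>g\<close> over the
  last column \<open>m\<close>. The last index is given by inequalities instead of as \<open>n - 1\<close>, which keeps
  truncated subtraction out of the entrywise computation.
\<close>

lemma column_conjugation:
  assumes "k < m" "m < n" "n \<le> Suc m"
  shows "unitriangular f * T k m r =
    unitriangular (\<lambda>i j. if j = m \<and> i < k then f i k * r else 0) * (T k m r * unitriangular f)"
    (is "_ = ?c * (_ * ?g)")
proof (intro mat_eqI)
  fix i j assume ij: "i < n" "j < n"
  have "(?c * T k m r) $$ (i, l) =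
      (if l = i then 1 else 0) + (if l = m then ?g $$ (i, k) * Unitization 0 r else 0)" if "l < n" for l
    using that ij assms
    by (auto simp: index_mult_T index_unitriangular simp del: index_mult_mat)
  then have "(?c * T k m r * ?g) $$ (i, j) = ?g $$ (i, j) + ?g $$ (i, k) * Unitization 0 r * ?g $$ (m, j)"
    using ij assms by (intro identity_plus_column_mult) simp_all
  also have "?c * T k m r * ?g = ?c * (T k m r * ?g)"
    by (rule assoc_mult_mat [of _ n n _ n _ n]) simp_all
  also have "?g $$ (i, j) + ?g $$ (i, k) * Unitization 0 r * ?g $$ (m, j) = (?g * T k m r) $$ (i, j)"
    using ij assms by (subst index_mult_T) (auto simp: index_unitriangular)
  finally show "(?g * T k m r) $$ (i, j) = (?c * (T k m r * ?g)) $$ (i, j)"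
    by (rule sym)
qed simp_all

text \<open>
  A matrix that differs from the identity only in row \<open>0\<close> gives up its entry at \<open>(0, j)\<close>: the commutator
  with \<open>T j 1 s\<close> is elementary. The row produced by \<open>row_conjugation\<close> has its
  nonzero off-diagonal entries to the right of column \<open>k \<ge> 1\<close>, so \<open>(0, 1)\<close> can serve as their common target.
\<close>

lemma row_commutator:
  assumes "1 < j" "j < n" "\<And>i l. i \<noteq> 0 \<Longrightarrow> f i l = 0"
  shows "unitriangular f * T j 1 s = T 0 1 (f 0 j * s) * (T j 1 s * unitriangular f)"
proof (intro mat_eqI)
  fix p q assume pq: "p < n" "q < n"
  have f: "unitriangular f $$ (p, q) = (if p = q then 1 else if p = 0 then Unitization 0 (f 0 q) else 0)"
    if "p < n" "q < n" for p q
    using that by (simp add: index_unitriangular assms(3))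
  show "(unitriangular f * T j 1 s) $$ (p, q) = (T 0 1 (f 0 j * s) * (T j 1 s * unitriangular f)) $$ (p, q)"
    using pq assms(1,2)
    by (cases "p = 0"; cases "q = 1"; cases "p = j")
      (simp_all add: index_T_mult index_mult_T f del: index_mult_mat)
qed simp_all

lemma column_commutator:
  assumes "i < m" "h < m" "i \<noteq> h" "m < n" "\<And>p q. q \<noteq> m \<Longrightarrow> f p q = 0"
  shows "T h i s * unitriangular f = T h m (s * f i m) * (unitriangular f * T h i s)"
proof (intro mat_eqI)
  fix p q assume pq: "p < n" "q < n"
  have m: "i < n" "h < n" "m < n" "i \<noteq> m" "h \<noteq> m" "h \<noteq> i" "m \<noteq> h"
    using assms by auto
  have f: "unitriangular f $$ (p, q) = (if p = q then 1 else if q = m \<and> p < m then Unitization 0 (f p m) else 0)"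
    if "p < n" "q < n" for p q
    using that by (auto simp: index_unitriangular assms(5))
  show "(T h i s * unitriangular f) $$ (p, q) = (T h m (s * f i m) * (unitriangular f * T h i s)) $$ (p, q)"
    using pq m \<open>i < m\<close>
    by (cases "p = h"; cases "q = m"; cases "q = i")
      (simp_all add: index_T_mult index_mult_T f del: index_mult_mat)
qed simp_all

text \<open>
  The two extraction lemmas together cover every position above the diagonal except \<open>(0, n - 1)\<close>: rows
  other than the first here, columns other than the last below. That they deliver at different
  positions is harmless, by \<open>sandwich_everywhere\<close>.
\<close>

lemma row_entry_extraction:
  assumes "N \<lhd> E" "unitriangular f \<in> N" "0 < k" "k < j" "j < n"
  shows "T 0 1 (r * f k j * s) \<in> N"
proof -
  let ?f = "\<lambda>(i :: nat) j. if i = 0 \<and> k < j then r * f k j else 0"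
  have "T 0 k r \<otimes>\<^bsub>E\<^esub> unitriangular f = unitriangular f \<otimes>\<^bsub>E\<^esub> (T 0 k r \<otimes>\<^bsub>E\<^esub> unitriangular ?f)"
    unfolding mult_E using assms by (intro row_conjugation) auto
  then have d: "unitriangular ?f \<in> N"
    by (rule E.conjugation_quotient_mem_normal [OF assms(1,2) T_in_E unitriangular_in_E, rotated -1])
      (use assms in auto)
  have "unitriangular ?f \<otimes>\<^bsub>E\<^esub> T j 1 s = T 0 1 (?f 0 j * s) \<otimes>\<^bsub>E\<^esub> (T j 1 s \<otimes>\<^bsub>E\<^esub> unitriangular ?f)"
    unfolding mult_E by (rule row_commutator [of j ?f s]) (use assms in auto)
  then have "T 0 1 (?f 0 j * s) \<in> N"
    by (rule E.commutator_mem_normal_left [OF assms(1) d T_in_E T_in_E, rotated -1])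
      (use assms in auto)
  then show ?thesis
    using assms(4) by simp
qed

lemma column_entry_extraction:
  assumes "N \<lhd> E" "unitriangular f \<in> N" "i < k" "Suc k < n"
  shows "T (n - 2) (n - 1) (r * f i k * s) \<in> N"
proof -
  let ?f = "\<lambda>i j :: nat. if j = n - 1 \<and> i < k then f i k * s else 0"
  have "unitriangular f \<otimes>\<^bsub>E\<^esub> T k (n - 1) s = unitriangular ?f \<otimes>\<^bsub>E\<^esub> (T k (n - 1) s \<otimes>\<^bsub>E\<^esub> unitriangular f)"
    unfolding mult_E using assms by (intro column_conjugation) auto
  then have c: "unitriangular ?f \<in> N"
    by (rule E.commutator_mem_normal_left [OF assms(1,2) T_in_E unitriangular_in_E, rotated -1])
      (use assms in auto)
  have "T (n - 1 - 1) i r \<otimes>\<^bsub>E\<^esub> unitriangular ?f =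
      T (n - 1 - 1) (n - 1) (r * ?f i (n - 1)) \<otimes>\<^bsub>E\<^esub> (unitriangular ?f \<otimes>\<^bsub>E\<^esub> T (n - 1 - 1) i r)"
    unfolding mult_E by (rule column_commutator) (use assms in auto)
  then have "T (n - 1 - 1) (n - 1) (r * ?f i (n - 1)) \<in> N"
    by (rule E.commutator_mem_normal_right [OF assms(1) T_in_E c T_in_E, rotated -1])
      (use assms in auto)
  moreover have "n - 1 - 1 = n - 2"
    by simp
  moreover have "r * ?f i (n - 1) = r * f i k * s"
    using assms(3) by (simp add: mult.assoc)
  ultimately show ?thesis
    by (simp only:)
qed

lemma T_mem_normal:
  assumes "N \<lhd> E" "i < n" "j < n" "k < n" "i \<noteq> j" "j \<noteq> k" "i \<noteq> k"
  shows "T i j r \<in> N \<Longrightarrow> T i k (r * s) \<in> N" "T j k s \<in> N \<Longrightarrow> T i k (r * s) \<in> N"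
proof -
  have *: "T i j r \<otimes>\<^bsub>E\<^esub> T j k s = T i k (r * s) \<otimes>\<^bsub>E\<^esub> (T j k s \<otimes>\<^bsub>E\<^esub> T i j r)"
    unfolding mult_E by (rule T_commutator [OF assms(2-7)])
  show "T i k (r * s) \<in> N" if "T i j r \<in> N"
    using assms by (intro E.commutator_mem_normal_left [OF assms(1) that _ _ *] T_in_E)
  show "T i k (r * s) \<in> N" if "T j k s \<in> N"
    using assms by (intro E.commutator_mem_normal_right [OF assms(1) _ that _ *] T_in_E)
qed

end

section \<open>Normal subgroups and the ideal of their entries\<close>

context idempotent_elementary
begin

text \<open>
  Elements of the form \<open>a * z * b\<close>, with \<open>z\<close> fixed, are the right objects to move between positions: a
  commutator that changes the column multiplies by one more element on the right, and by idempotence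
  the \<open>a * z * (b * b')\<close> with arbitrary \<open>b\<close> and \<open>b'\<close> additively generate all \<open>a * z * b\<close>. Changing the row
  multiplies on the left instead.
\<close>

lemma sandwich_move_column:
  assumes N: "N \<lhd> E" and ij: "i < n" "j < n" "k < n" "i \<noteq> j" "i \<noteq> k"
    and mem: "\<And>a b. T i j (a * z * b) \<in> N"
  shows "T i k (a * z * b) \<in> N"
proof (cases "j = k")
  case False
  have "{b. T i k (a * z * b) \<in> N} = UNIV"
    using root_subgroup [OF normal_imp_subgroup [OF N], of i k] ij False
      T_mem_normal(1) [OF N, of i j k] mem
    by (intro idempotent_subgroup_eq_UNIV [OF idem]) (auto simp: right_diff_distrib mult.assoc [symmetric])
  then show ?thesis
    by auto
qed (use mem in simp)

lemma sandwich_move_row: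
  assumes N: "N \<lhd> E" and ij: "i < n" "j < n" "k < n" "i \<noteq> k" "j \<noteq> k"
    and mem: "\<And>a b. T j k (a * z * b) \<in> N"
  shows "T i k (a * z * b) \<in> N"
proof (cases "i = j")
  case False
  have "{a. T i k (a * z * b) \<in> N} = UNIV"
    using root_subgroup [OF normal_imp_subgroup [OF N], of i k] ij False
      T_mem_normal(2) [OF N, of i j k] mem
    by (intro idempotent_subgroup_eq_UNIV [OF idem]) (auto simp: left_diff_distrib mult.assoc)
  then show ?thesis
    by auto
qed (use mem in simp)

text \<open>
  A move changes one coordinate and must not land on the diagonal. Going from \<open>(p, q)\<close> to \<open>(i, j)\<close>
  through \<open>(p, j)\<close> works unless \<open>j = p\<close>; in that case the column is first changed to some other index
  outside \<open>{i, p}\<close>.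
\<close>

lemma sandwich_everywhere:
  assumes N: "N \<lhd> E" and pq: "p < n" "q < n" "p \<noteq> q" and mem: "\<And>a b. T p q (a * z * b) \<in> N"
    and ij: "i < n" "j < n" "i \<noteq> j"
  shows "T i j (a * z * b) \<in> N"
proof -
  \<comment> \<open>column first, then row\<close>
  have off: "T i j (a * z * b) \<in> N" if "i < n" "j < n" "i \<noteq> j" "p \<noteq> j" for i j a b
    using that sandwich_move_row [OF N, of i p j z] sandwich_move_column [OF N, of p q j z] pq mem by blast
  show ?thesis
  proof (cases "j = p")
    case True
    obtain k where "k < n" "k \<noteq> i" "k \<noteq> p"
      using rank by (rule third_index)
    then show ?thesis
      using sandwich_move_column [OF N, of i k j z] off [of i k] ij by blast
  qed (use off ij in blast)
qed

text \<open>
  The elements \<open>z\<close> all of whose sandwiches \<open>a * z * b\<close> occur in \<open>N\<close> at every position form an ideal \<open>L\<close>,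
  because multiples of \<open>z\<close> can be absorbed into \<open>a\<close> or \<open>b\<close>. The ideal is defined by sandwiches since,
  in the absence of a unit, \<open>T p q z \<in> N\<close> need not give \<open>T i j z \<in> N\<close> at another position. When \<open>L\<close> is
  everything, \<open>N\<close> contains all triple products at all positions, which suffices by idempotence.
\<close>

lemma normal_eq_E_of_ideal_generators:
  assumes N: "N \<lhd> E" and Z: "rng_ideal_closure Z = (UNIV :: 'a set)"
    and mem: "\<And>z. z \<in> Z \<Longrightarrow> \<exists>p<n. \<exists>q<n. p \<noteq> q \<and> (\<forall>a b. T p q (a * z * b) \<in> N)"
  shows "N = carrier E"
proof (rule subgroup_eq_E_of_products [OF normal_imp_subgroup [OF N]])
  have sub: "subgroup N E"
    by (rule normal_imp_subgroup [OF N])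
  define L where "L = {z. \<forall>i<n. \<forall>j<n. i \<noteq> j \<longrightarrow> (\<forall>a b. T i j (a * z * b) \<in> N)}"
  have "z \<in> L" if "z \<in> Z" for z
    using mem [OF that] sandwich_everywhere [OF N] unfolding L_def by blast
  moreover have "r * z \<in> L" "z * r \<in> L" if "z \<in> L" for r z
  proof -
    have "a * (r * z) * b = a * r * z * b" "a * (z * r) * b = a * z * (r * b)" for a b
      by (simp_all only: mult.assoc)
    with that show "r * z \<in> L" "z * r \<in> L"
      unfolding L_def by simp_all
  qed
  ultimately have gens: "insert 0 (Z \<union> {r * z | r z. z \<in> Z} \<union> {z * r | r z. z \<in> Z} \<union> {r * z * s | r z s. z \<in> Z}) \<subseteq> L"
    using root_subgroup(1) [OF sub] by (auto simp: L_def)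
  have "z \<in> L" if "z \<in> rng_ideal_closure Z" for z
    using that unfolding rng_ideal_closure_def
  proof (induction rule: group_closure.induct)
    case (diff s t)
    have "a * (s - t) * b = a * s * b - a * t * b" for a b
      by (simp add: left_diff_distrib right_diff_distrib)
    with diff.IH show ?case
      using root_subgroup(2) [OF sub] unfolding L_def by simp
  next
    case (base s)
    then show ?case
      using gens by (rule subsetD [rotated])
  qed
  then have L: "L = UNIV"
    using Z by auto
  fix i j r s assume ij: "i < n" "j < n" "i \<noteq> j"
  have "{s. T i j (r * s) \<in> N} = UNIV"
    using root_subgroup [OF sub ij] L ij
    by (intro idempotent_subgroup_eq_UNIV [OF idem])
      (auto simp: right_diff_distrib L_def mult.assoc [symmetric] set_eq_iff)
  then show "T i j (r * s) \<in> N"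
    by auto
qed

text \<open>
  For entries in row \<open>0\<close> the column argument is used, for all others the row argument.
\<close>

lemma normal_eq_E_of_unitriangular:
  assumes N: "N \<lhd> E" and Z: "rng_ideal_closure Z = (UNIV :: 'a set)"
    and mem: "\<And>z. z \<in> Z \<Longrightarrow> \<exists>f i j. unitriangular f \<in> N \<and> i < j \<and> j < n \<and> (i, j) \<noteq> (0, n - 1) \<and> z = f i j"
  shows "N = carrier E"
proof (rule normal_eq_E_of_ideal_generators [OF N Z])
  fix z assume "z \<in> Z"
  then obtain f i j where f: "unitriangular f \<in> N" "i < j" "j < n" "(i, j) \<noteq> (0, n - 1)" "z = f i j"
    using mem by blast
  show "\<exists>p<n. \<exists>q<n. p \<noteq> q \<and> (\<forall>a b. T p q (a * z * b) \<in> N)"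
  proof (cases "i = 0")
    case True
    then show ?thesis
      using f column_entry_extraction [OF N f(1), of i j] rank
      by (intro exI [of _ "n - 2"] exI [of _ "n - 1"] conjI allI) auto
  next
    case False
    then show ?thesis
      using f row_entry_extraction [OF N f(1), of i j] rank
      by (intro exI [of _ 0] exI [of _ 1] conjI allI) auto
  qed
qed

end

section \<open>Ideals and the weight of a rng\<close>

definition two_sided_ideal :: "'b::ring set \<Rightarrow> bool" where
  "two_sided_ideal J \<longleftrightarrow> 0 \<in> J \<and> (\<forall>x\<in>J. \<forall>y\<in>J. x - y \<in> J) \<and> (\<forall>x\<in>J. \<forall>r. r * x \<in> J \<and> x * r \<in> J)"

lemma two_sided_idealD:
  assumes "two_sided_ideal J"
  shows "0 \<in> J" "x \<in> J \<Longrightarrow> y \<in> J \<Longrightarrow> x - y \<in> J" "x \<in> J \<Longrightarrow> y \<in> J \<Longrightarrow> x + y \<in> J"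
    "x \<in> J \<Longrightarrow> r * x \<in> J" "x \<in> J \<Longrightarrow> x * r \<in> J"
proof -
  show *: "0 \<in> J" "x \<in> J \<Longrightarrow> y \<in> J \<Longrightarrow> x - y \<in> J" "x \<in> J \<Longrightarrow> r * x \<in> J" "x \<in> J \<Longrightarrow> x * r \<in> J" for x y r
    using assms by (simp_all add: two_sided_ideal_def)
  show "x + y \<in> J" if "x \<in> J" "y \<in> J"
    using *(2) [OF that(1) *(2) [OF *(1) that(2)]] by simp
qed

lemma two_sided_ideal_sum:
  assumes "two_sided_ideal J" "\<And>k. k \<in> A \<Longrightarrow> f k \<in> J"
  shows "sum f A \<in> J"
  using assms(2) by (induction A rule: infinite_finite_induct) (auto intro: two_sided_idealD [OF assms(1)])

lemma subset_rng_ideal_closure: "Z \<subseteq> rng_ideal_closure Z"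
  unfolding rng_ideal_closure_def by (auto intro: group_closure.base)

lemma two_sided_ideal_rng_ideal_closure: "two_sided_ideal (rng_ideal_closure Z)"
proof -
  define X where "X = Z \<union> {r * z | r z. z \<in> Z} \<union> {z * r | r z. z \<in> Z} \<union> {r * z * s | r z s. z \<in> Z}"
  have X: "r * x \<in> X \<and> x * r \<in> X" if "x \<in> X" for r x
    using that unfolding X_def by (auto simp: mult.assoc) (metis mult.assoc)+
  have "r * x \<in> group_closure X \<and> x * r \<in> group_closure X" if "x \<in> group_closure X" for r x
    using that
  proof (induction rule: group_closure.induct)
    case (base s)
    then show ?case
      using X [of s r] by (auto intro: group_closure.base)
  next
    case (diff s t)
    then show ?case
      by (auto simp: left_diff_distrib right_diff_distrib intro: group_closure.diff)
  qed
  then show ?thesis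
    unfolding two_sided_ideal_def rng_ideal_closure_def X_def [symmetric]
    by (auto intro: group_closure.diff)
qed

lemma rng_closure_subset_rng_ideal_closure: "rng_closure S \<subseteq> rng_ideal_closure S"
proof
  fix r assume "r \<in> rng_closure S"
  then show "r \<in> rng_ideal_closure S"
    by (induction rule: rng_closure.induct)
      (use subset_rng_ideal_closure [of S] in \<open>auto intro: two_sided_idealD [OF two_sided_ideal_rng_ideal_closure]\<close>)
qed

text \<open>
  An ideal of the rng, regarded as an ideal of the unitization.
\<close>

definition unitization_ideal :: "'a::ring set \<Rightarrow> 'a unitization set" where
  "unitization_ideal I = {x. scalar_part x = 0 \<and> rng_part x \<in> I}"

lemma two_sided_ideal_unitization_ideal:
  assumes "two_sided_ideal I"
  shows "two_sided_ideal (unitization_ideal I)"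
proof -
  note I = two_sided_idealD [OF assms]
  have "int_smult k x \<in> I" if "x \<in> I" for k x
    unfolding int_smult_def using that by (intro I(2) two_sided_ideal_sum [OF assms])
  then show ?thesis
    by (auto simp: two_sided_ideal_def unitization_ideal_def times_unitization_def intro: I)
qed

lemma rng_weight_attained:
  assumes "finitely_generated_rng TYPE('a::ring)"
  obtains z :: "nat \<Rightarrow> 'a::ring" where "0 < rng_weight TYPE('a)"
    "rng_ideal_closure (z ` {..<rng_weight TYPE('a)}) = UNIV"
proof -
  obtain S :: "'a set" where S: "finite S" "rng_closure S = UNIV"
    using assms by (auto simp: finitely_generated_rng_def)
  have "rng_closure (insert 0 S) = UNIV"
    using S(2) rng_closure.induct [of _ S "\<lambda>x. x \<in> rng_closure (insert 0 S)"]
    by (auto intro: rng_closure.intros)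
  then have UNIV: "rng_ideal_closure (insert 0 S) = UNIV"
    using rng_closure_subset_rng_ideal_closure by blast
  obtain h where "bij_betw h {0..<card (insert 0 S)} (insert 0 S)"
    using ex_bij_betw_nat_finite S(1) by blast
  then have "h ` {..<card (insert 0 S)} = insert 0 S"
    by (simp add: bij_betw_def atLeast0LessThan)
  then have "0 < card (insert 0 S) \<and> (\<exists>z :: nat \<Rightarrow> 'a. rng_ideal_closure (z ` {..<card (insert 0 S)}) = UNIV)"
    using S(1) UNIV by (auto simp: card_gt_0_iff intro!: exI [of _ h])
  from LeastI [of "\<lambda>m. 0 < m \<and> (\<exists>z :: nat \<Rightarrow> 'a. rng_ideal_closure (z ` {..<m}) = UNIV)", OF this]
  show ?thesis
    using that by (auto simp: rng_weight_def)
qed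

text \<open>
  Generating families indexed by any finite set bound the weight; this avoids encoding the index
  triples of matrix entries as numbers.
\<close>

lemma rng_weight_le_card:
  assumes "finite X" "X \<noteq> {}" "rng_ideal_closure (f ` X) = (UNIV :: 'a::ring set)"
  shows "rng_weight TYPE('a) \<le> card X"
proof -
  obtain h where "bij_betw h {0..<card X} X"
    using ex_bij_betw_nat_finite assms(1) by blast
  then have "h ` {..<card X} = X"
    by (simp add: bij_betw_def atLeast0LessThan)
  then have "rng_ideal_closure ((f \<circ> h) ` {..<card X}) = UNIV"
    using assms(3) by (simp only: image_comp [symmetric])
  then show ?thesis
    unfolding rng_weight_def using assms(1,2) by (intro Least_le) (auto simp: card_gt_0_iff)
qed

section \<open>Congruence subgroups and the lower bound\<close>

context elementary
begin

definition entrywise_congruent :: "'a unitization set \<Rightarrow> 'a unitization mat \<Rightarrow> 'a unitization mat \<Rightarrow> bool" where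
  "entrywise_congruent J A B \<longleftrightarrow> (\<forall>i<n. \<forall>j<n. A $$ (i, j) - B $$ (i, j) \<in> J)"

lemma entrywise_congruent_refl: "two_sided_ideal J \<Longrightarrow> entrywise_congruent J A A"
  by (simp add: entrywise_congruent_def two_sided_idealD)

lemma entrywise_congruent_sym:
  assumes "two_sided_ideal J" "entrywise_congruent J A B"
  shows "entrywise_congruent J B A"
  unfolding entrywise_congruent_def
proof (intro allI impI)
  fix i j assume "i < n" "j < n"
  then have "0 - (A $$ (i, j) - B $$ (i, j)) \<in> J"
    using assms(2) by (intro two_sided_idealD(2) [OF assms(1) two_sided_idealD(1) [OF assms(1)]]) (simp add: entrywise_congruent_def)
  then show "B $$ (i, j) - A $$ (i, j) \<in> J"
    by simp
qed

lemma entrywise_congruent_mult: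
  assumes J: "two_sided_ideal J"
    and "A \<in> carrier_mat n n" "B \<in> carrier_mat n n" "C \<in> carrier_mat n n" "D \<in> carrier_mat n n"
    and AB: "entrywise_congruent J A B" and CD: "entrywise_congruent J C D"
  shows "entrywise_congruent J (A * C) (B * D)"
  unfolding entrywise_congruent_def
proof (intro allI impI)
  fix i j assume ij: "i < n" "j < n"
  have "(A * C) $$ (i, j) - (B * D) $$ (i, j) =
      (\<Sum>k<n. (A $$ (i, k) - B $$ (i, k)) * C $$ (k, j) + B $$ (i, k) * (C $$ (k, j) - D $$ (k, j)))"
    using assms ij by (simp add: index_mult_mat_sum left_diff_distrib right_diff_distrib sum_subtractf
        sum.distrib del: index_mult_mat)
  also have "\<dots> \<in> J"
    using AB CD ij by (intro two_sided_ideal_sum [OF J] two_sided_idealD(3-5) [OF J]) (auto simp: entrywise_congruent_def)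
  finally show "(A * C) $$ (i, j) - (B * D) $$ (i, j) \<in> J" .
qed

text \<open>
  The kernel of the reduction of \<open>E\<close> modulo \<open>J\<close>, without forming quotient rings.
\<close>

definition congruence_subgroup :: "'a unitization set \<Rightarrow> 'a unitization mat set" where
  "congruence_subgroup J = {g \<in> carrier E. entrywise_congruent J g (1\<^sub>m n)}"

lemma normal_congruence_subgroup:
  assumes J: "two_sided_ideal J"
  shows "congruence_subgroup J \<lhd> E"
proof (intro E.normal_inv_iff [THEN iffD2] conjI ballI E.subgroupI)
  note mult = entrywise_congruent_mult [OF J]
  show "congruence_subgroup J \<subseteq> carrier E"
    by (auto simp: congruence_subgroup_def)
  have "\<one>\<^bsub>E\<^esub> \<in> congruence_subgroup J"
    using E.one_closed by (simp add: congruence_subgroup_def entrywise_congruent_refl [OF J])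
  then show "congruence_subgroup J \<noteq> {}"
    by blast
  fix g assume "g \<in> congruence_subgroup J"
  then have g: "g \<in> carrier E" "entrywise_congruent J g (1\<^sub>m n)" "g \<in> carrier_mat n n"
    by (auto simp: congruence_subgroup_def carrier_E_mat)
  have conj: "entrywise_congruent J (x * g * inv\<^bsub>E\<^esub> x) (1\<^sub>m n)" if x: "x \<in> carrier E" for x
  proof -
    have x': "x \<in> carrier_mat n n" "inv\<^bsub>E\<^esub> x \<in> carrier_mat n n"
      using x by (auto intro: carrier_E_mat)
    have "entrywise_congruent J (x * g * inv\<^bsub>E\<^esub> x) (x * 1\<^sub>m n * inv\<^bsub>E\<^esub> x)"
      by (intro mult entrywise_congruent_refl [OF J] g(2)) (use x' g(3) in simp_all)
    moreover have "x * inv\<^bsub>E\<^esub> x = 1\<^sub>m n"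
      using E.r_inv [OF x] by simp
    ultimately show ?thesis
      using x' by simp
  qed
  show "inv\<^bsub>E\<^esub> g \<in> congruence_subgroup J"
  proof -
    have g': "inv\<^bsub>E\<^esub> g \<in> carrier E" "inv\<^bsub>E\<^esub> g \<in> carrier_mat n n"
      using g by (auto intro: carrier_E_mat)
    have "entrywise_congruent J (inv\<^bsub>E\<^esub> g * 1\<^sub>m n) (inv\<^bsub>E\<^esub> g * g)"
      by (intro mult entrywise_congruent_refl [OF J] entrywise_congruent_sym [OF J g(2)]) (use g g' in simp_all)
    moreover have "inv\<^bsub>E\<^esub> g * g = 1\<^sub>m n"
      using E.l_inv [OF g(1)] by simp
    ultimately show ?thesis
      using g' by (simp add: congruence_subgroup_def)
  qed
  show "g \<otimes>\<^bsub>E\<^esub> h \<in> congruence_subgroup J" if "h \<in> congruence_subgroup J" for h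
  proof -
    have h: "h \<in> carrier E" "entrywise_congruent J h (1\<^sub>m n)" "h \<in> carrier_mat n n"
      using that by (auto simp: congruence_subgroup_def carrier_E_mat)
    have "entrywise_congruent J (g * h) (1\<^sub>m n * 1\<^sub>m n)"
      by (intro mult g(2) h(2)) (use g h in simp_all)
    then show ?thesis
      using E.m_closed [OF g(1) h(1)] by (simp add: congruence_subgroup_def)
  qed
  show "x \<otimes>\<^bsub>E\<^esub> g \<otimes>\<^bsub>E\<^esub> inv\<^bsub>E\<^esub> x \<in> congruence_subgroup J" if x: "x \<in> carrier E" for x
    using conj [OF x] E.m_closed [OF E.m_closed [OF x g(1)] E.inv_closed [OF x]]
    by (simp add: congruence_subgroup_def)
qed

lemma entrywise_congruent_T_iff:
  assumes "two_sided_ideal I" "i < n" "j < n" "i \<noteq> j"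
  shows "entrywise_congruent (unitization_ideal I) (T i j r) (1\<^sub>m n) \<longleftrightarrow> r \<in> I"
proof -
  have diff: "T i j r $$ (p, q) - 1\<^sub>m n $$ (p, q) = (if p = i \<and> q = j then Unitization 0 r else 0)"
    if "p < n" "q < n" for p q
    using that assms(4) by (auto simp: elementary_matrix_def)
  have "entrywise_congruent (unitization_ideal I) (T i j r) (1\<^sub>m n) \<longleftrightarrow>
      (\<forall>p<n. \<forall>q<n. (if p = i \<and> q = j then Unitization 0 r else 0) \<in> unitization_ideal I)"
    by (simp only: entrywise_congruent_def diff cong: imp_cong)
  moreover have "0 \<in> unitization_ideal I" "Unitization 0 r \<in> unitization_ideal I \<longleftrightarrow> r \<in> I"
    using two_sided_idealD(1) [OF assms(1)] by (simp_all add: unitization_ideal_def)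
  ultimately show ?thesis
    using assms(2,3) by auto
qed

text \<open>
  Reduction modulo the rng itself is trivial on \<open>E\<close>, so the integer parts of the entries of a matrix in
  \<open>E\<close> are those of the identity matrix, and ideal membership of the entries is decided by their rng parts.
\<close>

lemma E_congruent_one:
  assumes "g \<in> carrier E"
  shows "entrywise_congruent (unitization_ideal UNIV) g (1\<^sub>m n)"
proof -
  have U: "two_sided_ideal (UNIV :: 'a set)"
    by (simp add: two_sided_ideal_def)
  have "congruence_subgroup (unitization_ideal UNIV) = carrier E"
    using normal_congruence_subgroup [OF two_sided_ideal_unitization_ideal [OF U]] entrywise_congruent_T_iff [OF U]
    by (intro subgroup_eq_E) (auto simp: congruence_subgroup_def normal_imp_subgroup T_in_E)
  then show ?thesis
    using assms by (auto simp: congruence_subgroup_def)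
qed

text \<open>
  Modulo the ideal generated by the rng parts of the entries of normal generators, these generators
  become trivial, and with them all of \<open>E\<close>. The diagonal entries are included without subtracting the
  identity matrix, whose rng parts are zero.
\<close>

lemma rng_weight_le:
  assumes "2 \<le> n" "0 < m" "g ` {..<m} \<subseteq> carrier E" "normal_closure E (g ` {..<m}) = carrier E"
  shows "rng_weight TYPE('a) \<le> m * n\<^sup>2"
proof -
  define X where "X = {..<m} \<times> {..<n} \<times> {..<n}"
  define entry where "entry = (\<lambda>(t, i, j). rng_part (g t $$ (i, j)))"
  define I where "I = rng_ideal_closure (entry ` X)"
  have I: "two_sided_ideal I"
    unfolding I_def by (rule two_sided_ideal_rng_ideal_closure)
  let ?N = "congruence_subgroup (unitization_ideal I)"
  have "g t \<in> ?N" if "t < m" for t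
  proof -
    have gt: "g t \<in> carrier E"
      using assms(3) that by auto
    have "rng_part (g t $$ (i, j)) \<in> I" if "i < n" "j < n" for i j
    proof -
      have "(t, i, j) \<in> X"
        using \<open>t < m\<close> that by (simp add: X_def)
      then have "entry (t, i, j) \<in> I"
        unfolding I_def by (intro subsetD [OF subset_rng_ideal_closure] imageI)
      then show ?thesis
        by (simp add: entry_def)
    qed
    then show ?thesis
      using E_congruent_one [OF gt] gt
      by (auto simp: congruence_subgroup_def entrywise_congruent_def unitization_ideal_def)
  qed
  then have "normal_closure E (g ` {..<m}) \<subseteq> ?N"
    unfolding normal_closure_def
    using normal_congruence_subgroup [OF two_sided_ideal_unitization_ideal [OF I]] by blast
  then have "carrier E \<subseteq> ?N"
    by (simp only: assms(4))
  then have "r \<in> I" for r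
    using T_in_E [of 0 1 r] entrywise_congruent_T_iff [OF I, of 0 1 r] assms(1)
    by (auto simp: congruence_subgroup_def)
  then have "rng_ideal_closure (entry ` X) = UNIV"
    unfolding I_def by blast
  then have "rng_weight TYPE('a) \<le> card X"
    using assms(1,2) by (intro rng_weight_le_card) (auto simp: X_def lessThan_empty_iff)
  then show ?thesis
    by (simp add: X_def card_cartesian_product power2_eq_square)
qed

end

section \<open>Packing ideal generators and the upper bound\<close>

lemma card_upper_positions:
  assumes "n \<ge> 3"
  shows "2 * card {(i, j). i < j \<and> j < n \<and> (i, j) \<noteq> (0, n - 1)} + n + 2 = n\<^sup>2"
proof -
  let ?U = "{(i, j). i < j \<and> j < n}"
  have U: "?U = (\<lambda>(j, i). (i, j)) ` (SIGMA j:{..<n}. {..<j})"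
    by force
  have "card ?U = card (SIGMA j:{..<n}. {..<j})"
    unfolding U by (intro card_image) (auto simp: inj_on_def)
  also have "\<dots> = \<Sum>{..<n}"
    by simp
  finally have card: "card ?U = \<Sum>{..<n}" .
  have sum: "2 * \<Sum>{..<n} + n = n\<^sup>2" for n :: nat
    by (induction n) (simp_all add: power2_eq_square)
  have eq: "{(i, j). i < j \<and> j < n \<and> (i, j) \<noteq> (0, n - 1)} = ?U - {(0, n - 1)}"
    by auto
  have "finite ?U"
    by (rule finite_subset [of _ "{..<n} \<times> {..<n}"]) auto
  moreover have "(0, n - 1) \<in> ?U"
    using assms by auto
  ultimately have "Suc (card {(i, j). i < j \<and> j < n \<and> (i, j) \<noteq> (0, n - 1)}) = card ?U"
    unfolding eq by (rule card_Suc_Diff1)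
  then show ?thesis
    using card sum [of n] by linarith
qed

context idempotent_elementary
begin

text \<open>
  With \<open>K\<close> the number of usable positions, the generator \<open>z u\<close> is placed in matrix \<open>u div K\<close> at the
  position numbered \<open>u mod K\<close>. If \<open>w < m * K\<close>, the remaining positions receive values of \<open>z\<close> beyond
  the generating family, which does no harm.
\<close>

lemma normal_generators:
  fixes z :: "nat \<Rightarrow> 'a"
  defines "K \<equiv> card {(i, j). i < j \<and> j < n \<and> (i, j) \<noteq> (0, n - 1)}"
  assumes z: "rng_ideal_closure (z ` {..<w}) = UNIV" and w: "w \<le> m * K"
  obtains g where "g ` {..<m} \<subseteq> carrier E" "normal_closure E (g ` {..<m}) = carrier E"
proof -
  let ?P = "{(i, j). i < j \<and> j < n \<and> (i, j) \<noteq> (0, n - 1)}"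
  have "finite ?P"
    by (rule finite_subset [of _ "{..<n} \<times> {..<n}"]) auto
  then obtain q where q: "bij_betw q ?P {0..<K}"
    unfolding K_def using ex_bij_betw_finite_nat by blast
  define f where "f = (\<lambda>t i j. z (t * K + q (i, j)))"
  define g where "g = (\<lambda>t. unitriangular (f t))"
  have carrier: "g ` {..<m} \<subseteq> carrier E"
    unfolding g_def using unitriangular_in_E by blast
  have "N = carrier E" if N: "N \<lhd> E" "g ` {..<m} \<subseteq> N" for N
  proof (rule normal_eq_E_of_unitriangular [OF N(1) z])
    fix x assume "x \<in> z ` {..<w}"
    then obtain u where u: "u < w" "x = z u"
      by blast
    then have "u < m * K"
      using w by simp
    then have "0 < K" "u div K < m"
      by (auto simp: less_mult_imp_div_less intro: gr0I)
    then have "u mod K \<in> q ` ?P"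
      using q by (simp add: bij_betw_def)
    then obtain i j where ij: "i < j" "j < n" "(i, j) \<noteq> (0, n - 1)" "q (i, j) = u mod K"
      by auto
    have "x = f (u div K) i j"
      using u(2) ij(4) by (simp add: f_def)
    moreover have "unitriangular (f (u div K)) \<in> N"
      using N(2) \<open>u div K < m\<close> by (auto simp: g_def)
    ultimately show "\<exists>f i j. unitriangular f \<in> N \<and> i < j \<and> j < n \<and> (i, j) \<noteq> (0, n - 1) \<and> x = f i j"
      using ij by blast
  qed
  moreover have "carrier E \<lhd> E"
    by (simp add: E.normal_inv_iff E.subgroup_self del: mult_E)
  ultimately have "{N. N \<lhd> E \<and> g ` {..<m} \<subseteq> N} = {carrier E}"
    using carrier by blast
  then have "normal_closure E (g ` {..<m}) = carrier E"
    by (simp add: normal_closure_def)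
  then show thesis
    using that carrier by blast
qed

text \<open>
  The hypothesis on \<open>m\<close> is \<open>2 * w \<le> m * (n\<^sup>2 - n - 2)\<close>, where \<open>w\<close> is the weight of the rng, with
  the subtraction moved to the other side. The lower bound also relies on the upper-bound construction:
  the least number defining the weight of the group is known to be attained only because some family of
  normal generators exists.
\<close>

lemma group_weight_bounds:
  assumes "finitely_generated_rng TYPE('a)"
  shows "rng_weight TYPE('a) \<le> group_weight E * n\<^sup>2"
    and "0 < m \<Longrightarrow> 2 * rng_weight TYPE('a) + m * (n + 2) \<le> m * n\<^sup>2 \<Longrightarrow> group_weight E \<le> m"
proof -
  let ?K = "card {(i, j). i < j \<and> j < n \<and> (i, j) \<noteq> (0, n - 1)}"
  let ?gen = "\<lambda>m. 0 < m \<and>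
    (\<exists>g :: nat \<Rightarrow> _. g ` {..<m} \<subseteq> carrier E \<and> normal_closure E (g ` {..<m}) = carrier E)"
  obtain z :: "nat \<Rightarrow> 'a" where w: "0 < rng_weight TYPE('a)"
    "rng_ideal_closure (z ` {..<rng_weight TYPE('a)}) = UNIV"
    using rng_weight_attained assms by blast
  have gen: "?gen m" if "0 < m" "rng_weight TYPE('a) \<le> m * ?K" for m
    using normal_generators [OF w(2) that(2)] that(1) by metis
  have K: "2 * ?K + n + 2 = n\<^sup>2"
    by (rule card_upper_positions [OF rank])
  have "3 * n \<le> n\<^sup>2"
    using rank by (simp add: power2_eq_square)
  then have "0 < ?K"
    using K rank by linarith
  then have "?gen (rng_weight TYPE('a))"
    using w(1) by (intro gen) simp_all
  then have "?gen (group_weight E)"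
    unfolding group_weight_def by (rule LeastI)
  then show "rng_weight TYPE('a) \<le> group_weight E * n\<^sup>2"
    using rng_weight_le rank by auto
  assume m: "0 < m" "2 * rng_weight TYPE('a) + m * (n + 2) \<le> m * n\<^sup>2"
  have "m * n\<^sup>2 = 2 * (m * ?K) + m * (n + 2)"
    by (simp add: K [symmetric] algebra_simps)
  then have "?gen m"
    using m by (intro gen) simp_all
  then show "group_weight E \<le> m"
    unfolding group_weight_def by (rule Least_le)
qed

end

theorem theorem7:
  fixes n :: nat
  assumes "finitely_generated_rng TYPE('a::ring)"
    and "(rng_square :: 'a set) = UNIV"
    and "n \<ge> 3"
  shows "finitely_generated_group (elementary_group TYPE('a) n)
    \<and> perfect_group (elementary_group TYPE('a) n)
    \<and> real (rng_weight TYPE('a)) / (real n)\<^sup>2 \<le> real (group_weight (elementary_group TYPE('a) n))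
    \<and> int (group_weight (elementary_group TYPE('a) n))
        \<le> \<lceil>2 * real (rng_weight TYPE('a)) / ((real n)\<^sup>2 - real n - 2)\<rceil>"
proof -
  interpret idempotent_elementary n "TYPE('a)"
    using assms by unfold_locales
  let ?w = "rng_weight TYPE('a)"
  define d where "d = (real n)\<^sup>2 - real n - 2"
  define m where "m = nat \<lceil>2 * real ?w / d\<rceil>"
  have "0 < ?w"
    using rng_weight_attained [OF assms(1)] by blast
  have "3 * real n \<le> (real n)\<^sup>2"
    using assms(3) by (simp add: power2_eq_square)
  then have "0 < d"
    using assms(3) by (simp add: d_def)
  then have pos: "0 < 2 * real ?w / d"
    using \<open>0 < ?w\<close> by simp
  then have m: "int m = \<lceil>2 * real ?w / d\<rceil>" "0 < m"
    by (simp_all add: m_def)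
  have "2 * real ?w / d \<le> real m"
    unfolding m_def by (rule real_nat_ceiling_ge)
  then have "2 * real ?w \<le> real m * d"
    using \<open>0 < d\<close> by (simp add: divide_le_eq)
  then have "real (2 * ?w + m * (n + 2)) \<le> real (m * n\<^sup>2)"
    by (simp add: d_def algebra_simps)
  then have "2 * ?w + m * (n + 2) \<le> m * n\<^sup>2"
    by (simp only: of_nat_le_iff)
  then have "int (group_weight E) \<le> \<lceil>2 * real ?w / d\<rceil>"
    using group_weight_bounds(2) [OF assms(1) m(2)] m(1) by simp
  moreover have "real ?w \<le> real (group_weight E) * (real n)\<^sup>2"
    using group_weight_bounds(1) [OF assms(1)] by (metis of_nat_le_iff of_nat_mult of_nat_power)
  then have "real ?w / (real n)\<^sup>2 \<le> real (group_weight E)"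
    using assms(3) by (simp add: divide_le_eq)
  ultimately show ?thesis
    using finitely_generated_E [OF assms(1,3)] perfect_E by (simp add: d_def)
qed

end
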